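(* Let $p$ be a prime, let $t$ be a positive integer, and let $n$ be an integer with $n \geq 12t+7$. Let $\mathcal{F}$ denote the set of all (not necessarily linear) maps $f : \mathbb{F}_p^n \to \mathbb{F}_p$, let $N = p^{p^n} = |\mathcal{F}|$, and identify $\mathbb{F}_p^N$ with the $\mathbb{F}_p$-vector space of all (not necessarily linear) maps $\mathcal{F} \to \mathbb{F}_p$. Define $\phi : \mathbb{F}_p^n \to \mathbb{F}_p^N$ by $$\phi(v)(f) = f(v) \qquad \text{for } v \in \mathbb{F}_p^n,\ f \in \mathcal{F}.$$ Let $$S = \{\phi(x+y) - \phi(x) - \phi(y) : x, y \in \mathbb{F}_p^n\} \subseteq \mathbb{F}_p^N.$$ Then there is no $\mathbb{F}_p$-linear map $\tilde{\phi} : \mathbb{F}_p^n \to \mathbb{F}_p^N$ such that $\phi(x) - \tilde{\phi}(x) \in tS$ for every $x \in \mathbb{F}_p^n$.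
   Context: $\mathbb{F}_p$ is the field with $p$ elements. For a subset $S$ of an abelian group and a positive integer $t$, $tS = \{s_1 + \cdots + s_t : s_1, \dots, s_t \in S\}$ denotes the $t$-fold sumset (repetitions allowed). *)

theory Defs
  imports "HOL-Analysis.Cartesian_Space"
    "HOL-Computational_Algebra.Primes"
begin

definition sumset :: "nat \<Rightarrow> 'g::ab_group_add set \<Rightarrow> 'g set" where
  "sumset t S = {(\<Sum>i<t. s i) | s. \<forall>i<t. s i \<in> S}"

text \<open>The index type \<open>'a ^ 'n \<Rightarrow> 'a\<close> is the finite type of all (not necessarily linear) maps
  from \<open>'a ^ 'n\<close> to \<open>'a\<close>. Over a field \<open>'a\<close> with \<open>p\<close> elements it has \<open>p ^ (p ^ n)\<close> elements,
  where \<open>n = CARD('n)\<close>.\<close>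

definition evalmap :: "('a::{field,finite}) ^ 'n \<Rightarrow> 'a ^ ('a ^ 'n \<Rightarrow> 'a)" where
  "evalmap v = (\<chi> f. f v)"

definition defects :: "('a::{field,finite} ^ ('a ^ 'n \<Rightarrow> 'a)) set" where
  "defects = {evalmap (x + y) - evalmap x - evalmap y | x y. True}"

end

theory Submission imports Defs begin

text \<open>Let \<open>G = 'a ^ 'n\<close>. The vectors \<open>evalmap v\<close> are linearly independent, so they span a copy of
  the group algebra of \<open>G\<close>, in which every element has a well-defined finite support. Suppose that
  \<open>\<psi>\<close> is a linear map with \<open>evalmap x - \<psi> x\<close> in the \<open>t\<close>-fold sumset of the defects. As a defect
  combines at most three basis vectors, \<open>\<psi> x\<close> always lies in this group algebra and has support of
  size at most \<open>3 * t + 1\<close>. Thus the image of \<open>\<psi>\<close> is a linear code all of whose words have weight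
  at most \<open>3 * t + 1\<close>.

  Averaging shows that such a code lives on few coordinates: a coordinate that is not identically
  zero is nonzero on at least half of the words, so at most \<open>6 * t + 2\<close> coordinates occur at all
  (lemma \<open>card_active_coordinates_le\<close>). On the other hand the code has dimension \<open>CARD('n)\<close>: each linear
  coordinate functional \<open>G \<rightarrow> 'a\<close> kills all defects, so \<open>x\<close> can be read off from \<open>\<psi> x\<close> and \<open>\<psi>\<close> is
  injective. Hence \<open>CARD('n) \<le> 6 * t + 2\<close>,
  contradicting \<open>CARD('n) \<ge> 12 * t + 7\<close>.\<close>

text \<open>Translation by \<open>u\<close> maps the kernel of \<open>L\<close> injectively into its complement.\<close>

lemma card_le_twice_card_nonzero:
  fixes L :: "'g::{ab_group_add,finite} \<Rightarrow> 'b::ab_group_add"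
  assumes add: "\<And>x y. L (x + y) = L x + L y" and u: "L u \<noteq> 0"
  shows "CARD('g) \<le> 2 * card {x. L x \<noteq> 0}"
proof -
  have "(\<lambda>x. x + u) ` {x. L x = 0} \<subseteq> {x. L x \<noteq> 0}"
    using u by (auto simp: add)
  then have "card {x. L x = 0} \<le> card {x. L x \<noteq> 0}"
    by (intro card_inj_on_le[where f = "\<lambda>x. x + u"]) (auto simp: inj_on_def)
  moreover have "CARD('g) = card {x. L x = 0} + card {x. L x \<noteq> 0}"
    by (subst card_Un_disjoint[symmetric]) (auto intro: arg_cong[where f = card])
  ultimately show ?thesis by simp
qed

text \<open>Count the pairs \<open>(i, x)\<close> with \<open>L i x \<noteq> 0\<close> in two ways: there are at most \<open>w\<close> for each \<open>x\<close>,
  and at least half of the group for each \<open>i\<close> that occurs.\<close>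

lemma card_active_coordinates_le:
  fixes L :: "'i::finite \<Rightarrow> 'g::{ab_group_add,finite} \<Rightarrow> 'b::ab_group_add"
  assumes add: "\<And>i x y. L i (x + y) = L i x + L i y"
    and few: "\<And>x. card {i. L i x \<noteq> 0} \<le> w"
  shows "card {i. \<exists>x. L i x \<noteq> 0} \<le> 2 * w"
proof -
  let ?M = "{i. \<exists>x. L i x \<noteq> 0}"
  have "card ?M * CARD('g) = (\<Sum>i\<in>?M. CARD('g))" by simp
  also have "\<dots> \<le> (\<Sum>i\<in>?M. 2 * card {x. L i x \<noteq> 0})"
    by (intro sum_mono) (use card_le_twice_card_nonzero[of "L _", OF add] in blast)
  also have "\<dots> \<le> 2 * (\<Sum>i\<in>UNIV. card {x. L i x \<noteq> 0})"
    unfolding sum_distrib_left by (intro sum_mono2) auto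
  also have "(\<Sum>i\<in>UNIV. card {x. L i x \<noteq> 0}) = (\<Sum>x\<in>UNIV. card {i. L i x \<noteq> 0})"
    using sum_multicount_gen[of UNIV UNIV "\<lambda>i x. L i x \<noteq> 0" "\<lambda>x. card {i. L i x \<noteq> 0}"] by simp
  also have "\<dots> \<le> CARD('g) * w"
    using sum_bounded_above[of UNIV "\<lambda>x. card {i. L i x \<noteq> 0}" w] few by simp
  finally have "CARD('g) * card ?M \<le> CARD('g) * (2 * w)" by (simp add: mult_ac)
  then show ?thesis by simp
qed

lemma card_le_power_active_coordinates:
  fixes L :: "'i::finite \<Rightarrow> 'g::{ab_group_add,finite} \<Rightarrow> 'b::{ab_group_add,finite}"
  assumes inj: "inj (\<lambda>x i. L i x)"
  shows "CARD('g) \<le> CARD('b) ^ card {i. \<exists>x. L i x \<noteq> 0}"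
proof -
  let ?M = "{i. \<exists>x. L i x \<noteq> 0}"
  let ?r = "\<lambda>x. restrict (\<lambda>i. L i x) ?M"
  have "inj ?r"
  proof (rule injI)
    fix x y assume eq: "?r x = ?r y"
    have "L i x = L i y" for i
      using fun_cong[OF eq, of i] by (cases "i \<in> ?M") (auto simp: restrict_def)
    then show "x = y" using injD[OF inj] by blast
  qed
  then have "CARD('g) \<le> card (?M \<rightarrow>\<^sub>E (UNIV :: 'b set))"
    by (intro card_inj_on_le[where f = ?r]) (auto simp: PiE_iff intro: finite_PiE split: if_splits)
  then show ?thesis by (simp add: card_PiE)
qed

text \<open>The coordinates indexed by spikes are the coefficients with respect to the basis
  \<open>evalmap v\<close> of the span of all evaluation vectors.\<close>

definition spike :: "'a ^ 'n \<Rightarrow> ('a::{field,finite}) ^ 'n::finite \<Rightarrow> 'a" where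
  "spike v = (\<lambda>u. if u = v then 1 else 0)"

definition point_support ::
  "('a::{field,finite}) ^ ('a ^ 'n::finite \<Rightarrow> 'a) \<Rightarrow> ('a ^ 'n) set" where
  "point_support z = {v. z $ spike v \<noteq> 0}"

text \<open>Membership in the span of the evaluation vectors, expressed by the expansion in that basis.\<close>

definition eval_combination :: "('a::{field,finite}) ^ ('a ^ 'n::finite \<Rightarrow> 'a) \<Rightarrow> bool" where
  "eval_combination z \<longleftrightarrow> (\<forall>f. z $ f = (\<Sum>v\<in>UNIV. f v * z $ spike v))"

lemma eval_combination_evalmap: "eval_combination (evalmap x)"
  by (simp add: eval_combination_def evalmap_def spike_def if_distrib cong: if_cong)

lemma eval_combination_expand:
  "eval_combination z \<Longrightarrow> z $ f = (\<Sum>v\<in>UNIV. f v * z $ spike v)"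
  unfolding eval_combination_def by blast

lemma eval_combination_diff:
  assumes "eval_combination a" "eval_combination b"
  shows "eval_combination (a - b)"
  unfolding eval_combination_def
proof
  fix f
  show "(a - b) $ f = (\<Sum>v\<in>UNIV. f v * (a - b) $ spike v)"
    unfolding vector_minus_component right_diff_distrib sum_subtractf
    by (intro arg_cong2[where f = minus] eval_combination_expand assms)
qed

lemma eval_combination_sum:
  assumes "\<And>i. i \<in> I \<Longrightarrow> eval_combination (s i)"
  shows "eval_combination (\<Sum>i\<in>I. s i)"
  unfolding eval_combination_def
proof
  fix f
  have "(\<Sum>i\<in>I. s i) $ f = (\<Sum>i\<in>I. \<Sum>v\<in>UNIV. f v * s i $ spike v)"
    unfolding sum_component by (intro sum.cong refl eval_combination_expand assms)
  also have "\<dots> = (\<Sum>v\<in>UNIV. f v * (\<Sum>i\<in>I. s i) $ spike v)"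
    unfolding sum_component sum_distrib_left by (rule sum.swap)
  finally show "(\<Sum>i\<in>I. s i) $ f = (\<Sum>v\<in>UNIV. f v * (\<Sum>i\<in>I. s i) $ spike v)" .
qed

lemma point_support_evalmap: "point_support (evalmap x) = {x}"
  by (auto simp: point_support_def evalmap_def spike_def)

lemma point_support_diff: "point_support (a - b) \<subseteq> point_support a \<union> point_support b"
  by (auto simp: point_support_def)

lemma point_support_sum: "point_support (\<Sum>i\<in>I. s i) \<subseteq> (\<Union>i\<in>I. point_support (s i))"
  by (auto simp: point_support_def dest: sum.not_neutral_contains_not_neutral)

lemma eval_combination_defects: "z \<in> defects \<Longrightarrow> eval_combination z"
  by (auto simp: defects_def intro!: eval_combination_diff eval_combination_evalmap)

lemma card_point_support_defects:
  assumes "z \<in> defects" shows "card (point_support z) \<le> 3"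
proof -
  obtain x y where z: "z = evalmap (x + y) - evalmap x - evalmap y"
    using assms by (auto simp: defects_def)
  have "point_support z \<subseteq> {x + y, x, y}"
    using point_support_diff[of "evalmap (x + y) - evalmap x" "evalmap y"]
      point_support_diff[of "evalmap (x + y)" "evalmap x"]
    by (auto simp: z point_support_evalmap)
  then have "card (point_support z) \<le> card {x + y, x, y}"
    by (intro card_mono) auto
  also have "\<dots> \<le> 3" using card_length[of "[x + y, x, y]"] by simp
  finally show ?thesis .
qed

lemma sumset_defects:
  assumes "z \<in> sumset t defects"
  shows "eval_combination z" "card (point_support z) \<le> 3 * t" "z $ (\<lambda>v. v $ j) = 0"
proof -
  obtain s where z: "z = (\<Sum>i<t. s i)" and s: "\<And>i. i < t \<Longrightarrow> s i \<in> defects"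
    using assms by (auto simp: sumset_def)
  show "eval_combination z"
    unfolding z by (intro eval_combination_sum eval_combination_defects s) simp
  have "card (point_support z) \<le> card (\<Union>i<t. point_support (s i))"
    unfolding z by (intro card_mono point_support_sum) auto
  also have "\<dots> \<le> (\<Sum>i<t. card (point_support (s i)))"
    by (intro card_UN_le) simp
  also have "\<dots> \<le> (\<Sum>i<t. 3)"
    by (intro sum_mono card_point_support_defects s) simp
  finally show "card (point_support z) \<le> 3 * t" by simp
  have "s i $ (\<lambda>v. v $ j) = 0" if "i < t" for i
    using s[OF that] by (auto simp: defects_def evalmap_def)
  then show "z $ (\<lambda>v. v $ j) = 0" by (simp add: z)
qed

theorem theorem2p1:
  fixes p t :: nat
  assumes "prime p" and "CARD('a::{field,finite}) = p"
    and "t > 0"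
    and "CARD('n::finite) \<ge> 12 * t + 7"
  shows "\<not> (\<exists>\<psi> :: 'a ^ 'n \<Rightarrow> 'a ^ ('a ^ 'n \<Rightarrow> 'a).
    Vector_Spaces.linear (*s) (*s) \<psi> \<and>
    (\<forall>x. evalmap x - \<psi> x \<in> sumset t defects))"
proof
  assume "\<exists>\<psi> :: 'a ^ 'n \<Rightarrow> 'a ^ ('a ^ 'n \<Rightarrow> 'a).
    Vector_Spaces.linear (*s) (*s) \<psi> \<and>
    (\<forall>x. evalmap x - \<psi> x \<in> sumset t defects)"
  then obtain \<psi> :: "'a ^ 'n \<Rightarrow> 'a ^ ('a ^ 'n \<Rightarrow> 'a)"
    where lin: "Vector_Spaces.linear (*s) (*s) \<psi>"
      and close: "\<And>x. evalmap x - \<psi> x \<in> sumset t defects"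
    by blast
  define L where "L v x = \<psi> x $ spike v" for v x
  have add: "L v (x + y) = L v x + L v y" for v x y
    by (simp add: L_def vec.linear_add[OF lin])
  have weight: "card {v. L v x \<noteq> 0} \<le> 3 * t + 1" for x
  proof -
    have "card {v. L v x \<noteq> 0} = card (point_support (\<psi> x))"
      by (simp add: L_def point_support_def)
    also have "\<dots> \<le> card ({x} \<union> point_support (evalmap x - \<psi> x))"
      using point_support_diff[of "evalmap x" "evalmap x - \<psi> x"]
      by (intro card_mono) (auto simp: point_support_evalmap)
    also have "\<dots> \<le> 1 + 3 * t"
      using card_Un_le[of "{x}" "point_support (evalmap x - \<psi> x)"] sumset_defects(2)[OF close[of x]]
      by simp
    finally show ?thesis by simp
  qed
  \<comment> \<open>The \<open>j\<close>-th linear coordinate functional vanishes on all defects, hence takes the same value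
    on \<open>\<psi> x\<close> as on \<open>evalmap x\<close>.\<close>
  have recover: "x $ j = (\<Sum>v\<in>UNIV. v $ j * L v x)" for x j
  proof -
    have "eval_combination (\<psi> x)"
      using eval_combination_diff[OF eval_combination_evalmap[of x] sumset_defects(1)[OF close[of x]]]
      by simp
    then have "\<psi> x $ (\<lambda>v. v $ j) = (\<Sum>v\<in>UNIV. v $ j * L v x)"
      unfolding L_def by (rule eval_combination_expand)
    moreover have "\<psi> x $ (\<lambda>v. v $ j) = x $ j"
      using sumset_defects(3)[OF close[of x], of j] by (simp add: evalmap_def)
    ultimately show ?thesis by simp
  qed
  have "inj (\<lambda>x v. L v x)"
  proof (rule injI)
    fix x y assume "(\<lambda>v. L v x) = (\<lambda>v. L v y)"
    then have "L v x = L v y" for v by (rule fun_cong)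
    then show "x = y" by (simp add: vec_eq_iff recover[of x] recover[of y])
  qed
  then have "CARD('a) ^ CARD('n) \<le> CARD('a) ^ card {v. \<exists>x. L v x \<noteq> 0}"
    using card_le_power_active_coordinates[of L] by simp
  moreover have "CARD('a) > 1"
    using assms(1,2) prime_gt_1_nat by simp
  ultimately have "CARD('n) \<le> card {v. \<exists>x. L v x \<noteq> 0}"
    by (metis power_le_imp_le_exp)
  also have "\<dots> \<le> 2 * (3 * t + 1)"
    by (rule card_active_coordinates_le[OF add weight])
  finally show False using assms(4) by simp
qed

end
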